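(* For every $d\in\mathbb{N}=\{1,2,\ldots\}$, we have $\mu(3,d)\le 5d/3$; that is, for any three complete flags $U^\bullet,V^\bullet,W^\bullet$ in $\mathbb{R}^d$ there is a set of at most $5d/3$ vectors that simultaneously generates $U^\bullet$, $V^\bullet$ and $W^\bullet$.
   Context: A (complete) flag $U^\bullet$ in $\mathbb{R}^d$ is a sequence of nested subspaces $\{0\}=U^0\subset U^1\subset\cdots\subset U^d=\mathbb{R}^d$ with $\dim U^i=i$ for each $i$. A set $S$ of vectors generates $U^\bullet$ if each $U^i$ is the span of some subset of $S$; equivalently, if $S$ contains a vector of $U^i\setminus U^{i-1}$ for each $i\in\{1,\ldots,d\}$. For flags $U_1^\bullet,\ldots,U_m^\bullet$ in $\mathbb{R}^d$, $\mu(U_1^\bullet,\ldots,U_m^\bullet)$ denotes the smallest possible size of a set of vectors that generates each of them (a simultaneous generating set), and $\mu(m,d)$ denotes the maximum of $\mu(U_1^\bullet,\ldots,U_m^\bullet)$ over all $m$-tuples of flags in $\mathbb{R}^d$. *)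

theory Defs
  imports "HOL-Analysis.Analysis"
begin

text \<open>A flag is a function on \<^typ>\<open>nat\<close>; only its values at the indices up to \<open>CARD('n)\<close> matter.\<close>

definition complete_flag :: "(nat \<Rightarrow> (real ^ 'n) set) \<Rightarrow> bool" where
  "complete_flag U \<longleftrightarrow>
     U 0 = {0} \<and> U CARD('n) = UNIV \<and>
     (\<forall>i<CARD('n). U i \<subset> U (Suc i)) \<and>
     (\<forall>i\<le>CARD('n). subspace (U i) \<and> dim (U i) = i)"

definition generates_flag :: "(real ^ 'n) set \<Rightarrow> (nat \<Rightarrow> (real ^ 'n) set) \<Rightarrow> bool" where
  "generates_flag S U \<longleftrightarrow> (\<forall>i\<le>CARD('n). \<exists>T\<subseteq>S. span T = U i)"

definition flag_mu :: "(nat \<Rightarrow> (real ^ 'n) set) list \<Rightarrow> nat" where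
  "flag_mu Us = (LEAST k. \<exists>S. finite S \<and> card S = k \<and> (\<forall>U\<in>set Us. generates_flag S U))"

text \<open>
  The dimension \<open>d = CARD('n)\<close> enters through the type argument. The maximum is over a set that
  is finite and nonempty by \<open>flag_mu_values_finite\<close> and \<open>flag_mu_values_nonempty\<close> below.
\<close>

definition max_mu :: "nat \<Rightarrow> ('n::finite) itself \<Rightarrow> nat" where
  "max_mu m _ = Max {flag_mu Us | Us :: (nat \<Rightarrow> (real ^ 'n) set) list.
                       length Us = m \<and> (\<forall>U\<in>set Us. complete_flag U)}"

lemma generates_flag_mono: "generates_flag S U \<Longrightarrow> S \<subseteq> S' \<Longrightarrow> generates_flag S' U"
  unfolding generates_flag_def by (meson subset_trans)

lemma complete_flag_generators:
  fixes U :: "nat \<Rightarrow> (real ^ 'n) set"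
  assumes "complete_flag U"
  shows "\<exists>S. finite S \<and> card S \<le> CARD('n) \<and> generates_flag S U"
proof -
  have "\<forall>i. \<exists>x. i < CARD('n) \<longrightarrow> x \<in> U (Suc i) - U i"
    using assms unfolding complete_flag_def by blast
  then obtain v where v: "\<And>i. i < CARD('n) \<Longrightarrow> v i \<in> U (Suc i) - U i"
    by metis
  have sub: "subspace (U i)" "dim (U i) = i" if "i \<le> CARD('n)" for i
    using assms that unfolding complete_flag_def by auto
  have "span (v ` {..<i}) = U i" if "i \<le> CARD('n)" for i
    using that
  proof (induction i)
    case 0
    then show ?case using assms by (simp add: complete_flag_def)
  next
    case (Suc i)
    then have IH: "span (v ` {..<i}) = U i" and i: "i < CARD('n)" by auto
    have up: "U i \<subseteq> U (Suc i)" using assms i unfolding complete_flag_def by auto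
    have "v ` {..<i} \<subseteq> U i" using span_superset[of "v ` {..<i}"] unfolding IH .
    then have "v ` {..<Suc i} \<subseteq> U (Suc i)"
      using up v[OF i] unfolding lessThan_Suc image_insert by blast
    then have s: "span (v ` {..<Suc i}) \<subseteq> U (Suc i)"
      using sub(1)[OF Suc.prems] by (simp add: span_minimal)
    have "dim (v ` {..<Suc i}) = Suc i"
    proof -
      have "dim (v ` {..<i}) = i" using IH sub(2)[of i] i by (metis dim_span less_imp_le)
      moreover have "v i \<notin> span (v ` {..<i})" using v[OF i] IH by auto
      ultimately show ?thesis by (simp add: lessThan_Suc dim_insert)
    qed
    then have "dim (U (Suc i)) \<le> dim (span (v ` {..<Suc i}))"
      using sub(2)[OF Suc.prems] by (simp only: dim_span)
    then show ?case
      by (rule subspace_dim_equal[OF subspace_span sub(1)[OF Suc.prems] s])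
  qed
  moreover have "v ` {..<i} \<subseteq> v ` {..<CARD('n)}" if "i \<le> CARD('n)" for i
    using that by auto
  ultimately have "generates_flag (v ` {..<CARD('n)}) U"
    unfolding generates_flag_def by blast
  then show ?thesis
    using card_image_le[of "{..<CARD('n)}" v] by (intro exI[of _ "v ` {..<CARD('n)}"]) auto
qed

lemma simultaneous_generators:
  fixes Us :: "(nat \<Rightarrow> (real ^ 'n) set) list"
  assumes "\<forall>U\<in>set Us. complete_flag U"
  shows "\<exists>S. finite S \<and> card S \<le> length Us * CARD('n) \<and> (\<forall>U\<in>set Us. generates_flag S U)"
  using assms
proof (induction Us)
  case Nil
  then show ?case by (intro exI[of _ "{}"]) auto
next
  case (Cons V Us)
  then obtain S where S: "finite S" "card S \<le> length Us * CARD('n)"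
      "\<forall>U\<in>set Us. generates_flag S U" by auto
  obtain T where T: "finite T" "card T \<le> CARD('n)" "generates_flag T V"
    using complete_flag_generators Cons.prems by (metis list.set_intros(1))
  have "card (S \<union> T) \<le> length (V # Us) * CARD('n)"
    using card_Un_le[of S T] S(2) T(2) by simp
  moreover have "\<forall>U\<in>set (V # Us). generates_flag (S \<union> T) U"
    using S(3) T(3) by (auto intro: generates_flag_mono)
  ultimately show ?case using S(1) T(1) by blast
qed

lemma flag_mu_le:
  assumes "finite S" "\<forall>U\<in>set Us. generates_flag S U"
  shows "flag_mu Us \<le> card S"
  unfolding flag_mu_def using assms by (intro Least_le) auto

lemma flag_mu_values_finite:
  "finite {flag_mu Us | Us :: (nat \<Rightarrow> (real ^ 'n) set) list.
             length Us = m \<and> (\<forall>U\<in>set Us. complete_flag U)}"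
proof (rule finite_subset)
  show "{flag_mu Us | Us :: (nat \<Rightarrow> (real ^ 'n) set) list.
           length Us = m \<and> (\<forall>U\<in>set Us. complete_flag U)} \<subseteq> {..m * CARD('n)}"
  proof
    fix k
    assume "k \<in> {flag_mu Us | Us :: (nat \<Rightarrow> (real ^ 'n) set) list.
                length Us = m \<and> (\<forall>U\<in>set Us. complete_flag U)}"
    then obtain Us :: "(nat \<Rightarrow> (real ^ 'n) set) list"
      where Us: "k = flag_mu Us" "length Us = m" "\<forall>U\<in>set Us. complete_flag U"
      by blast
    then obtain S where S: "finite S" "card S \<le> length Us * CARD('n)"
        "\<forall>U\<in>set Us. generates_flag S U"
      using simultaneous_generators by blast
    show "k \<in> {..m * CARD('n)}"
      using flag_mu_le[OF S(1,3)] S(2) Us by simp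
  qed
qed simp

lemma complete_flag_exists: "\<exists>U :: nat \<Rightarrow> (real ^ 'n) set. complete_flag U"
proof -
  obtain b :: "nat \<Rightarrow> real ^ 'n" where b: "bij_betw b {..<CARD('n)} Basis"
    using ex_bij_betw_nat_finite[of "Basis :: (real ^ 'n) set"]
    by (auto simp: atLeast0LessThan)
  have inj: "inj_on b {..<CARD('n)}" and im: "b ` {..<CARD('n)} = Basis"
    using b by (auto simp: bij_betw_def)
  have ind: "dim (span (b ` {..<i})) = i" if "i \<le> CARD('n)" for i
  proof -
    have "b ` {..<i} \<subseteq> Basis" using im that by (metis image_mono lessThan_subset_iff)
    then have "independent (b ` {..<i})" using independent_Basis independent_mono by blast
    moreover have "card (b ` {..<i}) = i"
      using inj that by (metis card_image card_lessThan inj_on_subset lessThan_subset_iff)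
    ultimately show ?thesis by (metis dim_eq_card_independent dim_span)
  qed
  have "span (b ` {..<i}) \<subset> span (b ` {..<Suc i})" if "i < CARD('n)" for i
  proof -
    have "span (b ` {..<i}) \<subseteq> span (b ` {..<Suc i})" by (intro span_mono image_mono) auto
    moreover have "span (b ` {..<i}) \<noteq> span (b ` {..<Suc i})"
      using ind[of i] ind[of "Suc i"] that by (metis Suc_leI less_imp_le n_not_Suc_n)
    ultimately show ?thesis by blast
  qed
  then have "complete_flag (\<lambda>i. span (b ` {..<i}))"
    unfolding complete_flag_def using ind im by (auto simp: span_Basis)
  then show ?thesis by blast
qed

lemma flag_mu_values_nonempty:
  "{flag_mu Us | Us :: (nat \<Rightarrow> (real ^ 'n) set) list.
      length Us = m \<and> (\<forall>U\<in>set Us. complete_flag U)} \<noteq> {}"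
proof -
  obtain U :: "nat \<Rightarrow> (real ^ 'n) set" where "complete_flag U"
    using complete_flag_exists by blast
  then have "length (replicate m U) = m \<and> (\<forall>V\<in>set (replicate m U). complete_flag V)"
    by simp
  then show ?thesis by blast
qed

end

theory Submission
  imports Defs "HOL-Combinatorics.Orbits"
begin

text \<open>
  The Bruhat decomposition of each pair of flags matches the steps of one flag bijectively with those
  of the other so that matched steps share a vector. Composing the three matchings cyclically gives a
  permutation of all \<open>3d\<close> steps in which every step shares a vector with its image. A cycle of even
  length \<open>n\<close> is covered by \<open>n / 2\<close> vectors, one of odd length by \<open>(n + 1) / 2\<close>; two odd cycles sharing a
  vector save one, and so does a 3-cycle with a vector common to its three steps. After greedy
  pairing, the remaining odd cycles share no vectors pairwise. Then no inversion of the matchings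
  involves two of them, so they form a chain: all steps of one precede all steps of the next.
  The quantity
  \<open>dim (A \<inter> B) + dim (B \<inter> C) + dim (C \<inter> A) - 2 dim (A \<inter> B \<inter> C)\<close> is monotone in the three
  subspaces, grows from \<open>0\<close> to \<open>d\<close> along the flags, and gains at least 3 across each remaining cycle.
  So at most \<open>d / 3\<close> cycles remain, and at most \<open>(3d + d / 3) / 2 = 5d / 3\<close> vectors are needed.
\<close>

section \<open>Bruhat matching of two flags\<close>

text \<open>
  Flags are continued as constant past the dimension, and steps are counted from 0: step \<open>i\<close> leads
  from \<open>U i\<close> to \<open>U (Suc i)\<close>.
\<close>

definition indexed_flag :: "(nat \<Rightarrow> 'a::euclidean_space set) \<Rightarrow> bool" where
  "indexed_flag U \<longleftrightarrow> (\<forall>i. subspace (U i)) \<and> mono U \<and> (\<forall>i. dim (U i) = min i DIM('a))"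

definition flag_step :: "(nat \<Rightarrow> 'a set) \<Rightarrow> nat \<Rightarrow> 'a set" where
  "flag_step U i = U (Suc i) - U i"

lemma indexed_flagD:
  assumes "indexed_flag (U :: nat \<Rightarrow> 'a::euclidean_space set)"
  shows "subspace (U i)" "mono U" "dim (U i) = min i DIM('a)"
  using assms by (auto simp: indexed_flag_def)

lemma indexed_flag_mono:
  assumes "indexed_flag U" "i \<le> j" shows "U i \<subseteq> U j"
  using monoD[OF indexed_flagD(2)[OF assms(1)] assms(2)] .

lemma indexed_flag_zero:
  assumes "indexed_flag U" shows "U 0 = {0}"
  using indexed_flagD(1)[OF assms, THEN subspace_0, of 0] indexed_flagD(3)[OF assms, of 0]
  by (auto simp: dim_eq_0)

lemma indexed_flag_full:
  assumes "indexed_flag (U :: nat \<Rightarrow> 'a::euclidean_space set)" shows "U DIM('a) = UNIV"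
  using indexed_flagD(1,3)[OF assms, of "DIM('a)"] by (metis dim_eq_full min.idem span_eq_iff)

text \<open>The quotient of \<open>U (Suc i)\<close> by \<open>U i\<close> has dimension at most 1,
  so the class of \<open>x\<close>, being nonzero, spans it.\<close>

lemma flag_step_mod:
  fixes U :: "nat \<Rightarrow> 'a::euclidean_space set"
  assumes U: "indexed_flag U" and x: "x \<in> flag_step U i" and z: "z \<in> U (Suc i)"
  shows "\<exists>c. z - c *\<^sub>R x \<in> U i"
proof -
  have sU: "span (U i) = U i" using indexed_flagD(1)[OF U] by (rule span_eq_iff[THEN iffD2])
  have x': "x \<in> U (Suc i)" "x \<notin> U i" using x by (auto simp: flag_step_def)
  have sub: "insert x (U i) \<subseteq> U (Suc i)"
    using x' indexed_flag_mono[OF U, of i "Suc i"] by auto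
  have "dim (insert x (U i)) = Suc (dim (U i))" unfolding dim_insert sU using x'(2) by simp
  moreover have "dim (U (Suc i)) \<le> Suc (dim (U i))" by (simp add: indexed_flagD(3)[OF U])
  ultimately have "span (insert x (U i)) = span (U (Suc i))"
    using sub by (intro dim_eq_span) simp_all
  then have "span (insert x (U i)) = U (Suc i)"
    using indexed_flagD(1)[OF U, of "Suc i"] by (simp only: span_eq_iff[THEN iffD2])
  then have "z \<in> span (insert x (U i))" using z by simp
  then show ?thesis using sU by (auto simp: span_insert)
qed

text \<open>This is the permutation describing the relative position of two flags in the Bruhat
  decomposition.\<close>

definition partner :: "(nat \<Rightarrow> 'a::euclidean_space set) \<Rightarrow> (nat \<Rightarrow> 'a set) \<Rightarrow> nat \<Rightarrow> nat" where
  "partner U V i = (LEAST j. \<not> U (Suc i) \<inter> V (Suc j) \<subseteq> U i)"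

context
  fixes U V :: "nat \<Rightarrow> 'a::euclidean_space set"
  assumes U: "indexed_flag U" and V: "indexed_flag V"
begin

lemma partner_last:
  assumes "i < DIM('a)"
  shows "\<not> U (Suc i) \<inter> V (Suc (DIM('a) - 1)) \<subseteq> U i"
proof
  have "Suc (DIM('a) - 1) = DIM('a)" by simp
  moreover assume "U (Suc i) \<inter> V (Suc (DIM('a) - 1)) \<subseteq> U i"
  ultimately have "U (Suc i) \<subseteq> U i" using indexed_flag_full[OF V] by auto
  then have "dim (U (Suc i)) \<le> dim (U i)" by (rule dim_subset)
  then show False using assms by (simp add: indexed_flagD(3)[OF U])
qed

lemma partner_less:
  assumes "i < DIM('a)" shows "partner U V i < DIM('a)"
proof -
  have "partner U V i \<le> DIM('a) - 1"
    unfolding partner_def using partner_last[OF assms] by (rule Least_le)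
  then show ?thesis using DIM_positive[where 'a = 'a] by linarith
qed

text \<open>Minimality excludes the index one below the partner; for partner 0 the claim rests on
  \<open>V 0 = {0}\<close>.\<close>

lemma partner_left:
  "U (Suc i) \<inter> V (partner U V i) \<subseteq> U i"
proof (cases "partner U V i")
  case 0
  then show ?thesis
    using indexed_flag_zero[OF V] subspace_0[OF indexed_flagD(1)[OF U]] by auto
next
  case (Suc j)
  then have "j < partner U V i" by simp
  then have "\<not> \<not> U (Suc i) \<inter> V (Suc j) \<subseteq> U i"
    unfolding partner_def by (rule not_less_Least)
  then show ?thesis using Suc by simp
qed

lemma partner_common:
  assumes "i < DIM('a)"
  shows "flag_step U i \<inter> flag_step V (partner U V i) \<noteq> {}"
proof -
  have "\<not> U (Suc i) \<inter> V (Suc (partner U V i)) \<subseteq> U i"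
    unfolding partner_def using partner_last[OF assms] by (rule LeastI)
  then show ?thesis using partner_left[of i] unfolding flag_step_def by blast
qed

text \<open>Mirror image of \<open>partner_left\<close>. If some \<open>z\<close> in
  \<open>U i\<close> took the step of \<open>V\<close>, subtracting a multiple of \<open>z\<close>
  from a common vector \<open>x\<close> of the two steps would land in \<open>V ?j\<close>, hence in
  \<open>U i\<close> by \<open>partner_left\<close>, and so \<open>x\<close> would lie in
  \<open>U i\<close>.\<close>

lemma partner_right:
  assumes "i < DIM('a)"
  shows "U i \<inter> V (Suc (partner U V i)) \<subseteq> V (partner U V i)"
proof (rule ccontr)
  let ?j = "partner U V i"
  assume "\<not> ?thesis"
  then obtain z where z: "z \<in> U i" "z \<in> flag_step V ?j" by (auto simp: flag_step_def)
  obtain x where x: "x \<in> flag_step U i" "x \<in> flag_step V ?j"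
    using partner_common[OF assms] by auto
  obtain c where c: "x - c *\<^sub>R z \<in> V ?j"
    using flag_step_mod[OF V z(2), of x] x(2) by (auto simp: flag_step_def)
  have cz: "c *\<^sub>R z \<in> U i" using z(1) by (simp add: indexed_flagD(1)[OF U] subspace_scale)
  then have "x - c *\<^sub>R z \<in> U (Suc i)"
    using x(1) indexed_flag_mono[OF U, of i "Suc i"] indexed_flagD(1)[OF U]
    by (auto simp: flag_step_def intro!: subspace_diff)
  then have "x - c *\<^sub>R z \<in> U i" using c partner_left[of i] by blast
  then have "x \<in> U i" using cz subspace_add[OF indexed_flagD(1)[OF U]] by fastforce
  then show False using x(1) by (simp add: flag_step_def)
qed

text \<open>A common vector of step \<open>i\<close> and its partner already lies in
  \<open>U i'\<close>; with equal partners it would violate \<open>partner_right\<close> for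
  \<open>i'\<close>.\<close>

lemma partner_neq:
  assumes "i < i'" "i' < DIM('a)"
  shows "partner U V i \<noteq> partner U V i'"
proof
  assume eq: "partner U V i = partner U V i'"
  obtain x where x: "x \<in> flag_step U i" "x \<in> flag_step V (partner U V i)"
    using partner_common[of i] assms by auto
  then have "x \<in> U i'" using indexed_flag_mono[OF U, of "Suc i" i'] assms by (auto simp: flag_step_def)
  then show False using partner_right[of i'] x(2) assms eq by (auto simp: flag_step_def)
qed

lemma inj_on_partner: "inj_on (partner U V) {..<DIM('a)}"
  by (rule inj_onI) (metis lessThan_iff nat_neq_iff partner_neq)

text \<open>The witness is the sum of the two common vectors: \<open>x\<close> lies in
  \<open>U i'\<close> and \<open>y\<close> in \<open>V ?j\<close>, so \<open>x + y\<close> takes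
  step \<open>i'\<close> of \<open>U\<close> because of \<open>y\<close> and step \<open>?j\<close>
  of \<open>V\<close> because of \<open>x\<close>.\<close>

lemma partner_inversion:
  assumes "i < i'" "i' < DIM('a)" "partner U V i' < partner U V i"
  shows "flag_step U i' \<inter> flag_step V (partner U V i) \<noteq> {}"
proof -
  let ?j = "partner U V i"
  obtain x where x: "x \<in> flag_step U i" "x \<in> flag_step V ?j"
    using partner_common[of i] assms by auto
  obtain y where y: "y \<in> flag_step U i'" "y \<in> flag_step V (partner U V i')"
    using partner_common[of i'] assms by auto
  have xU: "x \<in> U i'" using x(1) indexed_flag_mono[OF U, of "Suc i" i'] assms
    by (auto simp: flag_step_def)
  have yV: "y \<in> V ?j" using y(2) indexed_flag_mono[OF V, of "Suc (partner U V i')" ?j] assms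
    by (auto simp: flag_step_def)
  have "x + y \<in> U (Suc i')"
    using xU y(1) indexed_flag_mono[OF U, of i' "Suc i'"] indexed_flagD(1)[OF U]
    by (auto simp: flag_step_def intro!: subspace_add)
  moreover have "x + y \<notin> U i'"
    using xU y(1) subspace_diff[OF indexed_flagD(1)[OF U], of "x + y" i' x]
    by (auto simp: flag_step_def)
  moreover have "x + y \<in> V (Suc ?j)"
    using yV x(2) indexed_flag_mono[OF V, of ?j "Suc ?j"] indexed_flagD(1)[OF V]
    by (auto simp: flag_step_def intro!: subspace_add)
  moreover have "x + y \<notin> V ?j"
    using yV x(2) subspace_diff[OF indexed_flagD(1)[OF V], of "x + y" ?j y]
    by (auto simp: flag_step_def)
  ultimately show ?thesis by (auto simp: flag_step_def)
qed

end

section \<open>A monotone function of three subspaces\<close>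

text \<open>For subspaces spanned by subsets of one basis, this counts the basis vectors lying in at
  least two of them.\<close>

definition overlap :: "'a::euclidean_space set \<Rightarrow> 'a set \<Rightarrow> 'a set \<Rightarrow> int" where
  "overlap A B C = int (dim (A \<inter> B)) + int (dim (B \<inter> C)) + int (dim (C \<inter> A))
     - 2 * int (dim (A \<inter> B \<inter> C))"

lemma dim_less_subspace:
  fixes S T :: "'a::euclidean_space set"
  assumes "subspace S" "subspace T" "S \<subseteq> T" "x \<in> T" "x \<notin> S"
  shows "dim S < dim T"
proof (rule dim_psubset)
  have "span S = S" "span T = T" using assms(1,2) by (simp_all only: span_eq_iff[THEN iffD2])
  moreover have "S \<subset> T" using assms(3-5) by auto
  ultimately show "span S \<subset> span T" by (simp only:)
qed

lemma overlap_rotate: "overlap A B C = overlap B C A"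
  unfolding overlap_def by (simp add: ac_simps)

text \<open>Enlarging \<open>A\<close> raises the triple intersection by at most as much as
  \<open>A \<inter> B\<close>: the subspaces \<open>A' \<inter> B \<inter> C\<close> and
  \<open>A \<inter> B\<close> meet in \<open>A \<inter> B \<inter> C\<close>, and their sum lies in
  \<open>A' \<inter> B\<close>.\<close>

lemma dim_Int_increment:
  fixes A A' B C :: "'a::euclidean_space set"
  assumes "subspace A" "subspace A'" "subspace B" "subspace C" "A \<subseteq> A'"
  shows "dim (A' \<inter> B \<inter> C) + dim (A \<inter> B) \<le> dim (A' \<inter> B) + dim (A \<inter> B \<inter> C)"
proof -
  let ?S = "A' \<inter> B \<inter> C" and ?T = "A \<inter> B"
  have S: "subspace ?S" "subspace ?T" using assms by (auto intro: subspace_inter)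
  have "{x + y |x y. x \<in> ?S \<and> y \<in> ?T} \<subseteq> A' \<inter> B"
    using assms by (auto intro!: subspace_add)
  then have "dim {x + y |x y. x \<in> ?S \<and> y \<in> ?T} \<le> dim (A' \<inter> B)" by (rule dim_subset)
  moreover have "?S \<inter> ?T = A \<inter> B \<inter> C" using assms(5) by auto
  ultimately show ?thesis using dim_sums_Int[OF S] by simp
qed

text \<open>The growth of \<open>A \<inter> B\<close> and that of \<open>C \<inter> A\<close> each
  pay for one of the two subtracted triple terms.\<close>

lemma overlap_mono1:
  assumes "subspace A" "subspace A'" "subspace B" "subspace C" "A \<subseteq> A'"
  shows "overlap A B C \<le> overlap A' B C"
  using dim_Int_increment[OF assms] dim_Int_increment[OF assms(1,2,4,3,5)]
  unfolding overlap_def by (simp add: Int_commute Int_left_commute)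

lemma overlap_mono:
  assumes "subspace A" "subspace B" "subspace C" "subspace A'" "subspace B'" "subspace C'"
    and "A \<subseteq> A'" "B \<subseteq> B'" "C \<subseteq> C'"
  shows "overlap A B C \<le> overlap A' B' C'"
proof -
  have "overlap A B C \<le> overlap A' B C" by (intro overlap_mono1 assms)
  also have "\<dots> \<le> overlap A' B' C"
    unfolding overlap_rotate[of A'] by (intro overlap_mono1 assms)
  also have "\<dots> \<le> overlap A' B' C'"
    unfolding overlap_rotate[of A' B'] overlap_rotate[of B' _ A'] by (intro overlap_mono1 assms)
  finally show ?thesis .
qed

text \<open>A telescoping sum in which the increments outside \<open>J\<close>, being nonnegative,
  are dropped.\<close>

lemma mono_count_increments:
  fixes g :: "nat \<Rightarrow> int"
  assumes "\<And>i. g i \<le> g (Suc i)" "\<And>j. j \<in> J \<Longrightarrow> g j + 1 \<le> g (Suc j)"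
    and "J \<subseteq> {a..<b}" "a \<le> b"
  shows "g a + int (card J) \<le> g b"
proof -
  have "int (card J) = (\<Sum>j\<in>J. 1)" by simp
  also have "\<dots> \<le> (\<Sum>j\<in>J. g (Suc j) - g j)" using assms(2) by (intro sum_mono) fastforce
  also have "\<dots> \<le> (\<Sum>j=a..<b. g (Suc j) - g j)" using assms(1,3) by (intro sum_mono2) auto
  also have "\<dots> = g b - g a" using assms(4) by (rule sum_Suc_diff')
  finally show ?thesis by simp
qed

section \<open>Greedy covers\<close>

definition covers :: "('v \<Rightarrow> 'x set) \<Rightarrow> 'v set \<Rightarrow> nat \<Rightarrow> bool" where
  "covers h Y k \<longleftrightarrow> (\<exists>S. finite S \<and> card S \<le> k \<and> (\<forall>y\<in>Y. S \<inter> h y \<noteq> {}))"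

lemma covers_empty: "covers h {} 0"
  unfolding covers_def by (intro exI[of _ "{}"]) auto

lemma covers_Un:
  assumes "covers h Y k" "covers h Z l" shows "covers h (Y \<union> Z) (k + l)"
proof -
  obtain S T where "finite S" "card S \<le> k" "\<forall>y\<in>Y. S \<inter> h y \<noteq> {}"
    "finite T" "card T \<le> l" "\<forall>y\<in>Z. T \<inter> h y \<noteq> {}"
    using assms unfolding covers_def by blast
  then show ?thesis unfolding covers_def using card_Un_le[of S T]
    by (intro exI[of _ "S \<union> T"]) (auto simp: Int_Un_distrib2)
qed

lemma covers_single:
  assumes "\<Inter>(h ` Y) \<noteq> {}" shows "covers h Y 1"
proof -
  obtain x where "x \<in> \<Inter>(h ` Y)" using assms by blast
  then show ?thesis unfolding covers_def by (intro exI[of _ "{x}"]) auto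
qed

text \<open>Here \<open>n\<close> is a budget of half-vectors. Such budgets add up under unions
  without rounding, so the savings from pairing odd sets can be tracked.\<close>

definition halved :: "('v \<Rightarrow> 'x set) \<Rightarrow> 'v set \<Rightarrow> nat \<Rightarrow> bool" where
  "halved h Y n \<longleftrightarrow> (\<exists>k. covers h Y k \<and> 2 * k \<le> n)"

lemma halved_Un:
  assumes "halved h Y m" "halved h Z n" shows "halved h (Y \<union> Z) (m + n)"
proof -
  obtain k l where "covers h Y k" "2 * k \<le> m" "covers h Z l" "2 * l \<le> n"
    using assms unfolding halved_def by blast
  then show ?thesis unfolding halved_def
    by (intro exI[of _ "k + l"]) (auto intro: covers_Un)
qed

lemma halved_Union:
  assumes "finite Q" "\<And>A. A \<in> Q \<Longrightarrow> halved h A (n A)"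
  shows "halved h (\<Union>Q) (\<Sum>A\<in>Q. n A)"
  using assms
proof induction
  case empty
  show ?case using covers_empty by (auto simp: halved_def)
next
  case (insert A Q)
  then show ?case using halved_Un[of h A "n A" "\<Union>Q" "\<Sum>A\<in>Q. n A"] by simp
qed

text \<open>Induction over \<open>P\<close>, with \<open>Q\<close> the sets not yet served. A new
  set that can be halved alone is served; one that can be halved together with some \<open>B\<close>
  in \<open>Q\<close> is served with \<open>B\<close>, which leaves \<open>Q\<close>; any other set
  enters \<open>Q\<close>.\<close>

lemma greedy_halving:
  assumes "finite P"
  obtains Q where "Q \<subseteq> P"
    "\<And>A. A \<in> Q \<Longrightarrow> \<not> halved h A (card A)"
    "\<And>A B. A \<in> Q \<Longrightarrow> B \<in> Q \<Longrightarrow> A \<noteq> B \<Longrightarrow> \<not> halved h (A \<union> B) (card A + card B)"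
    "halved h (\<Union>(P - Q)) (\<Sum>A\<in>P - Q. card A)"
proof -
  define ok where "ok P Q \<longleftrightarrow> Q \<subseteq> P \<and> (\<forall>A\<in>Q. \<not> halved h A (card A)) \<and>
    (\<forall>A\<in>Q. \<forall>B\<in>Q. A \<noteq> B \<longrightarrow> \<not> halved h (A \<union> B) (card A + card B)) \<and>
    halved h (\<Union>(P - Q)) (\<Sum>A\<in>P - Q. card A)" for P Q
  have "\<exists>Q. ok P Q" using assms(1)
  proof induction
    case empty
    show ?case using covers_empty by (intro exI[of _ "{}"]) (auto simp: ok_def halved_def)
  next
    case (insert A P)
    then obtain Q where Q: "ok P Q" by auto
    then have fin: "finite (P - Q)" "finite Q" "Q \<subseteq> P"
      using insert.hyps finite_subset by (auto simp: ok_def)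
    have rest: "halved h (\<Union>(P - Q)) (\<Sum>A\<in>P - Q. card A)" using Q by (simp add: ok_def)
    consider "halved h A (card A)"
      | B where "B \<in> Q" "halved h (A \<union> B) (card A + card B)"
      | "\<not> halved h A (card A)" "\<And>B. B \<in> Q \<Longrightarrow> \<not> halved h (A \<union> B) (card A + card B)"
      by blast
    then show ?case
    proof cases
      case 1
      have "insert A P - Q = insert A (P - Q)" using insert.hyps fin by auto
      then have "ok (insert A P) Q"
        using Q insert.hyps fin halved_Un[OF 1 rest] by (auto simp: ok_def)
      then show ?thesis by blast
    next
      case 2
      have eq: "insert A P - (Q - {B}) = insert A (insert B (P - Q))"
        using insert.hyps fin 2 by auto
      have "A \<noteq> B" using insert.hyps fin 2 by auto
      then have "ok (insert A P) (Q - {B})"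
        using Q insert.hyps fin 2 halved_Un[OF 2(2) rest] unfolding ok_def eq
        by (auto simp: Un_assoc add.assoc)
      then show ?thesis by blast
    next
      case 3
      have "insert A P - insert A Q = P - Q" using insert.hyps fin by auto
      then have "ok (insert A P) (insert A Q)"
        using Q 3 by (auto simp: ok_def Un_commute add.commute)
      then show ?thesis by blast
    qed
  qed
  then show thesis using that unfolding ok_def by metis
qed

section \<open>Covering cycles\<close>

lemma cyclic_on_enumerate:
  assumes "cyclic_on f S" "y \<in> S"
  shows "S = (\<lambda>n. (f ^^ n) y) ` {..<card S}"
    and "inj_on (\<lambda>n. (f ^^ n) y) {..<card S}"
    and "(f ^^ card S) y = y"
proof -
  \<comment> \<open>The first return time of \<open>y\<close>, which turns out to be the length of
    the cycle.\<close>
  define N where "N = funpow_dist1 f y y"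
  have orb: "orbit f y = S" using assms by (rule orbit_cyclic_eq3)
  then have y: "y \<in> orbit f y" using assms(2) by simp
  have inj: "inj_on (\<lambda>n. (f ^^ n) y) {..<N}"
    using inj_on_funpow_dist1[OF y] by (simp only: N_def atLeast0LessThan)
  have img: "S = (\<lambda>n. (f ^^ n) y) ` {..<N}"
    using orbit_conv_funpow_dist1[OF y] orb by (simp only: N_def atLeast0LessThan)
  then have N: "card S = N" using card_image[OF inj] by simp
  show "S = (\<lambda>n. (f ^^ n) y) ` {..<card S}" using img N by simp
  show "inj_on (\<lambda>n. (f ^^ n) y) {..<card S}" using inj N by simp
  show "(f ^^ card S) y = y" using funpow_dist1_prop[OF y] unfolding N N_def .
qed

lemma cyclic_on_card_pos: "cyclic_on f S \<Longrightarrow> 0 < card S"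
  using finite_cyclic_on[of f S] by (auto simp: card_gt_0_iff cyclic_on_alldef)

lemma cyclic_on_preimage:
  assumes "cyclic_on f S" "y \<in> S"
  obtains x where "x \<in> S" "f x = y"
proof
  let ?x = "(f ^^ (card S - 1)) y"
  show "?x \<in> S" using assms by (rule cyclic_on_funpow_in)
  have "f ?x = (f ^^ Suc (card S - 1)) y" by simp
  also have "Suc (card S - 1) = card S" using cyclic_on_card_pos[OF assms(1)] by simp
  finally show "f ?x = y" using cyclic_on_enumerate(3)[OF assms] by simp
qed

text \<open>Split the arc into consecutive pairs and spend one shared vector on each.\<close>

lemma covers_arc:
  assumes "\<And>n. h ((f ^^ n) y) \<inter> h ((f ^^ Suc n) y) \<noteq> {}"
  shows "covers h ((\<lambda>n. (f ^^ n) y) ` {a..<a + 2 * k}) k"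
proof (induction k)
  case 0
  show ?case by (simp add: covers_empty)
next
  case (Suc k)
  let ?n = "a + 2 * k"
  have "{a..<a + 2 * Suc k} = {a..<?n} \<union> {?n, Suc ?n}" by auto
  moreover have "covers h ((\<lambda>n. (f ^^ n) y) ` {?n, Suc ?n}) 1"
    using assms[of ?n] by (intro covers_single) auto
  ultimately show ?case using covers_Un[OF Suc.IH] by (simp only: image_Un Suc_eq_plus1)
qed

context
  fixes f :: "'v \<Rightarrow> 'v" and h :: "'v \<Rightarrow> 'x set" and S :: "'v set"
  assumes cyc: "cyclic_on f S" and link: "\<And>y. y \<in> S \<Longrightarrow> h y \<inter> h (f y) \<noteq> {}"
begin

lemma cyclic_link:
  assumes "y \<in> S" shows "h ((f ^^ n) y) \<inter> h ((f ^^ Suc n) y) \<noteq> {}"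
  using link[OF cyclic_on_funpow_in[OF cyc assms]] by simp

lemma halved_cyclic:
  assumes "even (card S)" shows "halved h S (card S)"
proof -
  obtain y where y: "y \<in> S" using cyc by (auto simp: cyclic_on_def)
  obtain k where k: "card S = 2 * k" using assms by blast
  have "S = (\<lambda>n. (f ^^ n) y) ` {0..<0 + 2 * k}"
    using cyclic_on_enumerate(1)[OF cyc y] by (simp add: k atLeast0LessThan)
  then have "covers h S k" using covers_arc[of h f y 0 k] cyclic_link[OF y] by simp
  then show ?thesis using k unfolding halved_def by auto
qed

text \<open>Removing one point from an odd cycle leaves an arc of even length, starting at
  \<open>f y\<close>.\<close>

lemma halved_cyclic_remove:
  assumes "odd (card S)" "y \<in> S" shows "halved h (S - {y}) (card S - 1)"
proof -
  obtain k where k: "card S = Suc (2 * k)" using assms by (auto elim: oddE)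
  let ?g = "\<lambda>n. (f ^^ n) y"
  have S: "S = ?g ` {..<Suc (2 * k)}" and inj: "inj_on ?g {..<Suc (2 * k)}"
    using cyclic_on_enumerate(1,2)[OF cyc assms(2), unfolded k] .
  have "S - {y} = ?g ` {..<Suc (2 * k)} - ?g ` {0}" using S by simp
  also have "\<dots> = ?g ` ({..<Suc (2 * k)} - {0})"
    using inj by (intro inj_on_image_set_diff[symmetric]) auto
  also have "{..<Suc (2 * k)} - {0} = {1..<1 + 2 * k}" by auto
  finally have "covers h (S - {y}) k" using covers_arc[of h f y 1 k] cyclic_link[OF assms(2)] by simp
  then show ?thesis using k unfolding halved_def by auto
qed

lemma halved_cyclic_Suc: "halved h S (Suc (card S))"
proof (cases "even (card S)")
  case True
  then show ?thesis using halved_cyclic unfolding halved_def by auto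
next
  case False
  obtain y where y: "y \<in> S" using cyc by (auto simp: cyclic_on_def)
  \<comment> \<open>Since \<open>link\<close> makes \<open>h y\<close> nonempty, \<open>y\<close>
    costs one vector of its own, that is two halves.\<close>
  have "halved h {y} 2" using covers_single[of h "{y}"] link[OF y] unfolding halved_def by force
  then have "halved h ({y} \<union> (S - {y})) (2 + (card S - 1))"
    using halved_cyclic_remove[OF False y] by (rule halved_Un)
  moreover have "{y} \<union> (S - {y}) = S" using y by auto
  moreover have "2 + (card S - 1) = Suc (card S)" using cyclic_on_card_pos[OF cyc] by simp
  ultimately show ?thesis by simp
qed

end

text \<open>One shared vector serves \<open>y\<close> and \<open>z\<close>, and the two remaining
  arcs have even length.\<close>

lemma halved_cyclic_join:
  assumes "cyclic_on f S" "\<And>y. y \<in> S \<Longrightarrow> h y \<inter> h (f y) \<noteq> {}" "odd (card S)" "y \<in> S"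
    and "cyclic_on f T" "\<And>y. y \<in> T \<Longrightarrow> h y \<inter> h (f y) \<noteq> {}" "odd (card T)" "z \<in> T"
    and "h y \<inter> h z \<noteq> {}"
  shows "halved h (S \<union> T) (card S + card T)"
proof -
  have "halved h {y, z} 2"
    using covers_single[of h "{y, z}"] assms(9) unfolding halved_def by force
  then have "halved h ({y, z} \<union> ((S - {y}) \<union> (T - {z}))) (2 + ((card S - 1) + (card T - 1)))"
    using assms by (intro halved_Un halved_cyclic_remove[of f])
  moreover have "{y, z} \<union> ((S - {y}) \<union> (T - {z})) = S \<union> T" using assms by auto
  moreover have "2 + ((card S - 1) + (card T - 1)) = card S + card T"
    using cyclic_on_card_pos[OF assms(1)] cyclic_on_card_pos[OF assms(5)] by simp
  ultimately show ?thesis by (simp only:)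
qed

section \<open>Three flags\<close>

locale three_flags =
  fixes F :: "nat \<Rightarrow> nat \<Rightarrow> 'a::euclidean_space set"
  assumes flag: "indexed_flag (F t)"
begin

section \<open>The permutation of all steps of three flags\<close>

definition steps :: "(nat \<times> nat) set" where
  "steps = {..<3} \<times> {..<DIM('a)}"

definition hits :: "nat \<times> nat \<Rightarrow> 'a set" where
  "hits y = flag_step (F (fst y)) (snd y)"

text \<open>Fixing everything outside \<open>steps\<close> makes this a permutation in the sense of
  \<open>permutes\<close>, which has a decomposition into cycles.\<close>

definition turn :: "nat \<times> nat \<Rightarrow> nat \<times> nat" where
  "turn y = (if y \<in> steps
     then (Suc (fst y) mod 3, partner (F (fst y)) (F (Suc (fst y) mod 3)) (snd y)) else y)"

lemma turn_in_steps: "y \<in> steps \<Longrightarrow> turn y \<in> steps"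
  using partner_less[OF flag flag] by (auto simp: turn_def steps_def)

lemma Suc_mod_3_eq: "a < 3 \<Longrightarrow> b < 3 \<Longrightarrow> Suc a mod 3 = Suc b mod 3 \<Longrightarrow> a = b"
  by (auto simp: mod_Suc split: if_splits)

lemma fst_turn: "y \<in> steps \<Longrightarrow> fst (turn y) = Suc (fst y) mod 3"
  by (simp add: turn_def)

lemma steps_fst: "y \<in> steps \<Longrightarrow> fst y < 3"
  by (auto simp: steps_def)

lemma turn_permutes: "turn permutes steps"
proof -
  have fin: "finite steps" by (simp add: steps_def)
  have "inj_on turn steps"
  proof (rule inj_onI)
    fix y z assume y: "y \<in> steps" and z: "z \<in> steps" and eq: "turn y = turn z"
    then have "fst y = fst z" by (auto simp: turn_def steps_def intro: Suc_mod_3_eq)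
    moreover from this have "snd y = snd z"
      using eq y z inj_on_partner[OF flag flag, of "fst z" "Suc (fst z) mod 3"]
      by (auto simp: turn_def steps_def dest: inj_onD)
    ultimately show "y = z" by (rule prod_eqI)
  qed
  moreover have "turn ` steps \<subseteq> steps" using turn_in_steps by auto
  ultimately have "bij_betw turn steps steps"
    using endo_inj_surj[OF fin] by (auto simp: bij_betw_def)
  then show ?thesis by (rule bij_imp_permutes) (simp add: turn_def)
qed

lemma hits_turn: "y \<in> steps \<Longrightarrow> hits y \<inter> hits (turn y) \<noteq> {}"
  using partner_common[OF flag flag, of "snd y" "fst y" "Suc (fst y) mod 3"]
  by (auto simp: turn_def steps_def hits_def)

text \<open>As \<open>turn y\<close> lies on the cycle of \<open>y\<close>, an inversion between
  steps of two cycles makes these cycles share a vector.\<close>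

lemma hits_inversion:
  assumes "y \<in> steps" "z \<in> steps" "fst y = fst z" "snd y < snd z" "snd (turn z) < snd (turn y)"
  shows "hits z \<inter> hits (turn y) \<noteq> {}"
  using partner_inversion[OF flag flag, of "snd y" "snd z" "fst y" "Suc (fst y) mod 3"] assms
  by (auto simp: turn_def steps_def hits_def)

lemma fst_turn_funpow:
  assumes "y \<in> steps" shows "(turn ^^ n) y \<in> steps \<and> fst ((turn ^^ n) y) = (fst y + n) mod 3"
proof (induction n)
  case 0
  show ?case using assms by (auto simp: steps_def)
next
  case (Suc n)
  then show ?case using turn_in_steps by (simp add: fst_turn mod_Suc_eq)
qed

section \<open>Cycles of the permutation\<close>

definition cycle :: "(nat \<times> nat) set \<Rightarrow> bool" where
  "cycle S \<longleftrightarrow> cyclic_on turn S \<and> S \<subseteq> steps"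

lemma cycleD:
  assumes "cycle S"
  shows "cyclic_on turn S" "S \<subseteq> steps" "\<And>y. y \<in> S \<Longrightarrow> hits y \<inter> hits (turn y) \<noteq> {}"
    "finite S" "\<And>y. y \<in> S \<Longrightarrow> turn y \<in> S"
proof -
  show cyc: "cyclic_on turn S" and sub: "S \<subseteq> steps" using assms by (auto simp: cycle_def)
  show "hits y \<inter> hits (turn y) \<noteq> {}" if "y \<in> S" for y using that sub hits_turn by blast
  show "finite S" using cyc by (rule finite_cyclic_on)
  show "turn y \<in> S" if "y \<in> S" for y using cyc that by (rule cyclic_on_inI)
qed

text \<open>Each \<open>turn\<close> advances the flag index by 1 modulo 3, so a return takes a
  multiple of 3 turns.\<close>

lemma cycle_card_dvd: 
  assumes "cycle S" shows "3 dvd card S"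
proof -
  obtain y where y: "y \<in> S" using assms by (auto simp: cyclic_on_def cycle_def)
  then have ys: "y \<in> steps" using cycleD(2)[OF assms] by auto
  have "fst y = (fst y + card S) mod 3"
    using cyclic_on_enumerate(3)[OF cycleD(1)[OF assms] y] fst_turn_funpow[OF ys, of "card S"] by simp
  moreover have "fst y < 3" using ys by (auto simp: steps_def)
  ultimately show ?thesis by presburger
qed

lemma cycle_ex_type:
  assumes "cycle S" "t < 3" obtains i where "(t, i) \<in> S"
proof -
  obtain y where y: "y \<in> S" using assms by (auto simp: cyclic_on_def cycle_def)
  then have ys: "y \<in> steps" using cycleD(2)[OF assms(1)] by auto
  \<comment> \<open>Adding 3 keeps the subtraction on \<open>nat\<close> from truncating and
    vanishes modulo 3.\<close>
  let ?z = "(turn ^^ (t + 3 - fst y)) y"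
  have "fst y < 3" using ys by (auto simp: steps_def)
  then have "fst ?z = t" using fst_turn_funpow[OF ys, of "t + 3 - fst y"] assms(2) by simp
  moreover have "?z \<in> S" using cyclic_on_funpow_in[OF cycleD(1)[OF assms(1)] y] .
  ultimately show thesis using that[of "snd ?z"] by (metis prod.collapse)
qed

section \<open>Cycles without shared vectors form a chain\<close>

definition below :: "(nat \<times> nat) set \<Rightarrow> (nat \<times> nat) set \<Rightarrow> bool" where
  "below S T \<longleftrightarrow> (\<forall>t i j. (t, i) \<in> S \<longrightarrow> (t, j) \<in> T \<longrightarrow> i < j)"

text \<open>
  Without inversions between \<open>S\<close> and \<open>T\<close>, \<open>turn\<close> preserves the order of a step of \<open>S\<close> and one of \<open>T\<close>.
\<close>

lemma cycle_belowI:
  assumes S: "cycle S" and T: "cycle T" and disj: "S \<inter> T = {}"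
    and apart: "\<And>y z. y \<in> S \<Longrightarrow> z \<in> T \<Longrightarrow> hits y \<inter> hits z = {}"
    and y: "y \<in> S" and least: "\<And>z. z \<in> T \<Longrightarrow> fst z = fst y \<Longrightarrow> snd y < snd z"
  shows "below S T"
proof -
  have ind: "\<forall>z\<in>T. fst z = fst ((turn ^^ n) y) \<longrightarrow> snd ((turn ^^ n) y) < snd z" for n
  proof (induction n)
    case 0
    show ?case using least by auto
  next
    case (Suc n)
    let ?y = "(turn ^^ n) y"
    have yS: "?y \<in> S" using cyclic_on_funpow_in[OF cycleD(1)[OF S] y] .
    then have ys: "?y \<in> steps" using cycleD(2)[OF S] by auto
    show ?case
    proof (intro ballI impI)
      fix z assume z: "z \<in> T" and type: "fst z = fst ((turn ^^ Suc n) y)"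
      \<comment> \<open>The preimage \<open>w\<close> is compared with \<open>?y\<close> by
        induction. A reversal under \<open>turn\<close> would be an inversion and give
        \<open>w\<close> in \<open>T\<close> and \<open>turn ?y\<close> in \<open>S\<close> a common
        vector.\<close>
      obtain w where w: "w \<in> T" "turn w = z" using cyclic_on_preimage[OF cycleD(1)[OF T] z] .
      then have ws: "w \<in> steps" using cycleD(2)[OF T] by auto
      have eq: "fst w = fst ?y"
      proof (rule Suc_mod_3_eq)
        show "Suc (fst w) mod 3 = Suc (fst ?y) mod 3"
          using type fst_turn[OF ws] fst_turn[OF ys] w(2) by simp
      qed (use steps_fst ws ys in blast)+
      then have lt: "snd ?y < snd w" using Suc.IH w(1) by blast
      have "\<not> snd z < snd (turn ?y)"
      proof
        assume "snd z < snd (turn ?y)"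
        then have "hits w \<inter> hits (turn ?y) \<noteq> {}"
          using hits_inversion[OF ys ws _ lt] eq w(2) by simp
        then show False using apart[OF cycleD(5)[OF S yS] w(1)] by blast
      qed
      moreover have "snd z \<noteq> snd (turn ?y)"
      proof
        assume "snd z = snd (turn ?y)"
        then have "z = turn ?y" using type by (intro prod_eqI) simp_all
        then show False using z cycleD(5)[OF S yS] disj by blast
      qed
      ultimately show "snd ((turn ^^ Suc n) y) < snd z" by simp
    qed
  qed
  show ?thesis unfolding below_def
  proof (intro allI impI)
    fix t i j assume i: "(t, i) \<in> S" and j: "(t, j) \<in> T"
    obtain n where "(t, i) = (turn ^^ n) y" using cyclic_on_enumerate(1)[OF cycleD(1)[OF S] y] i by auto
    then show "i < j" using ind[of n] j by (metis fst_conv snd_conv)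
  qed
qed

text \<open>The lowest step of flag 0 on either cycle belongs to just one of them and precedes all
  steps of flag 0 on the other, which is the start that \<open>cycle_belowI\<close> needs.\<close>

lemma cycles_below_cases:
  assumes S: "cycle S" and T: "cycle T" and disj: "S \<inter> T = {}"
    and apart: "\<And>y z. y \<in> S \<Longrightarrow> z \<in> T \<Longrightarrow> hits y \<inter> hits z = {}"
  shows "below S T \<or> below T S"
proof -
  define I where "I = {i. (0, i) \<in> S \<union> T}"
  have "I \<subseteq> snd ` (S \<union> T)" unfolding I_def by force
  then have fin: "finite I" using cycleD(4) S T by (meson finite_UnI finite_imageI finite_subset)
  have "I \<noteq> {}" using cycle_ex_type[OF S, of 0] unfolding I_def by auto
  then have "Min I \<in> I" using fin by (rule Min_in[rotated])
  moreover have min: "Min I \<le> i" if "(0, i) \<in> S \<union> T" for i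
    using fin that by (auto simp: I_def intro: Min_le)
  ultimately consider "(0, Min I) \<in> S" | "(0, Min I) \<in> T" by (auto simp: I_def)
  then show ?thesis
  proof cases
    case 1
    have "below S T"
    proof (rule cycle_belowI[OF S T disj apart 1])
      fix z assume "z \<in> T" "fst z = fst (0 :: nat, Min I)"
      then show "snd (0 :: nat, Min I) < snd z"
        using min[of "snd z"] disj 1 by (cases z) (auto simp: le_less)
    qed
    then show ?thesis ..
  next
    case 2
    have "below T S"
    proof (rule cycle_belowI[OF T S _ _ 2])
      show "T \<inter> S = {}" using disj by auto
      show "hits y \<inter> hits z = {}" if "y \<in> T" "z \<in> S" for y z using apart[OF that(2,1)] by auto
      fix z assume "z \<in> S" "fst z = fst (0 :: nat, Min I)"
      then show "snd (0 :: nat, Min I) < snd z"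
        using min[of "snd z"] disj 2 by (cases z) (auto simp: le_less)
    qed
    then show ?thesis ..
  qed
qed

section \<open>Gain of the overlap across a cycle\<close>

lemma subspace_F: "subspace (F t i)"
  using indexed_flagD(1)[OF flag] .

lemma F_mono: "i \<le> j \<Longrightarrow> F t i \<subseteq> F t j"
  using indexed_flag_mono[OF flag] .

definition level :: "nat \<Rightarrow> nat \<Rightarrow> nat \<Rightarrow> int" where
  "level a b c = overlap (F 0 a) (F 1 b) (F 2 c)"

lemma level_mono:
  assumes "a \<le> a'" "b \<le> b'" "c \<le> c'" shows "level a b c \<le> level a' b' c'"
  unfolding level_def using assms by (intro overlap_mono subspace_F F_mono)

lemma level_zero: "level 0 0 0 = 0"
  by (simp add: level_def overlap_def indexed_flag_zero[OF flag])

lemma level_full: "level DIM('a) DIM('a) DIM('a) = int DIM('a)"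
  by (simp add: level_def overlap_def indexed_flag_full[OF flag])

lemma turn_less:
  assumes "(t, i) \<in> steps" "turn (t, i) = (s, j)"
  shows "F t (Suc i) \<inter> F s j \<subseteq> F t i" "F t i \<inter> F s (Suc j) \<subseteq> F s j"
    "\<exists>x. x \<in> F t (Suc i) \<and> x \<notin> F t i \<and> x \<in> F s (Suc j) \<and> x \<notin> F s j"
  using partner_left[OF flag flag, of t i s] partner_right[OF flag flag, of i t s]
    partner_common[OF flag flag, of i t s] assms
  by (auto simp: turn_def steps_def flag_step_def)

definition lo :: "(nat \<times> nat) set \<Rightarrow> nat \<Rightarrow> nat" where
  "lo S t = Min {i. (t, i) \<in> S}"

text \<open>Because of \<open>Suc\<close>, \<open>F t (hi S t)\<close> is the subspace after the
  last step of \<open>S\<close> in flag \<open>t\<close>, whereas \<open>F t (lo S t)\<close> is the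
  one before the first.\<close>

definition hi :: "(nat \<times> nat) set \<Rightarrow> nat \<Rightarrow> nat" where
  "hi S t = Suc (Max {i. (t, i) \<in> S})"

lemma cycle_column:
  assumes "cycle S" "t < 3"
  shows "finite {i. (t, i) \<in> S}" "{i. (t, i) \<in> S} \<noteq> {}"
proof -
  have "{i. (t, i) \<in> S} \<subseteq> snd ` S" by force
  then show "finite {i. (t, i) \<in> S}" using cycleD(4)[OF assms(1)] finite_subset by blast
  show "{i. (t, i) \<in> S} \<noteq> {}" using cycle_ex_type[OF assms] by auto
qed

lemma cycle_bounds:
  assumes "cycle S" "t < 3" "(t, i) \<in> S" shows "lo S t \<le> i" "i < hi S t"
  using cycle_column[OF assms(1,2)] assms(3) by (auto simp: lo_def hi_def less_Suc_eq_le)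

lemma lo_less_hi:
  assumes "cycle S" "t < 3" shows "lo S t < hi S t"
  using cycle_bounds[OF assms] cycle_ex_type[OF assms] by (meson le_less_trans)

lemma hi_le:
  assumes "cycle S" "t < 3" shows "hi S t \<le> DIM('a)"
  using cycle_column[OF assms] cycleD(2)[OF assms(1)] unfolding hi_def Suc_le_eq
  by (subst Max_less_iff) (auto simp: steps_def)

lemma below_hi_le_lo:
  assumes "below S T" "cycle S" "cycle T" "t < 3" shows "hi S t \<le> lo T t"
proof -
  have "(t, Max {i. (t, i) \<in> S}) \<in> S" using Max_in[OF cycle_column[OF assms(2,4)]] by simp
  moreover have "(t, lo T t) \<in> T" using Min_in[OF cycle_column[OF assms(3,4)]] by (simp add: lo_def)
  ultimately show ?thesis using assms(1) by (auto simp: below_def hi_def Suc_le_eq)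
qed

text \<open>
  Raise flag 0 across the cycle, then flag 1, then flag 2. When flag 1 passes a step of the cycle,
  the matched step of flag 0 has been taken and that of flag 2 has not, so \<open>level\<close> gains 1; a cycle
  of length at least 9 has at least three such steps.
\<close>

lemma level_gain_long:
  assumes S: "cycle S" and card: "9 \<le> card S"
  shows "level (lo S 0) (lo S 1) (lo S 2) + 3 \<le> level (hi S 0) (hi S 1) (hi S 2)"
proof -
  define J where "J = {j. (1, j) \<in> S}"
  define g where "g j = level (hi S 0) j (lo S 2)" for j
  obtain j0 where j0: "(1, j0) \<in> S" using cycle_ex_type[OF S, of 1] by auto
  \<comment> \<open>Every third turn comes back to flag 1; the exponents 0, 3, 6 are below the cycle
    length, so these three steps differ.\<close>
  define e where "e r = (turn ^^ (3 * r)) (1, j0)" for r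
  have eS: "e r \<in> S" for r unfolding e_def using cyclic_on_funpow_in[OF cycleD(1)[OF S] j0] .
  have efst: "fst (e r) = 1" for r
    using fst_turn_funpow[of "(1, j0)" "3 * r"] j0 cycleD(2)[OF S] by (auto simp: e_def)
  have "inj_on (\<lambda>r. snd (e r)) {..<3}"
  proof (rule inj_onI)
    fix r s assume rs: "r \<in> {..<3::nat}" "s \<in> {..<3::nat}" and "snd (e r) = snd (e s)"
    then have "e r = e s" using efst by (intro prod_eqI) simp_all
    moreover have "3 * r \<in> {..<card S}" "3 * s \<in> {..<card S}" using rs card by auto
    ultimately have "3 * r = 3 * s"
      using cyclic_on_enumerate(2)[OF cycleD(1)[OF S] j0] unfolding e_def inj_on_def by blast
    then show "r = s" by simp
  qed
  moreover have "(\<lambda>r. snd (e r)) ` {..<3} \<subseteq> J"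
    using eS efst unfolding J_def by (auto, metis prod.collapse)
  moreover have "finite J" unfolding J_def using cycle_column[OF S] by simp
  ultimately have "card {..<3::nat} \<le> card J" by (rule card_inj_on_le)
  moreover have "level (lo S 0) (lo S 1) (lo S 2) \<le> g (lo S 1)"
    unfolding g_def using lo_less_hi[OF S, of 0] by (intro level_mono) simp_all
  ultimately have "level (lo S 0) (lo S 1) (lo S 2) + 3 \<le> g (lo S 1) + int (card J)" by simp
  also have "\<dots> \<le> g (hi S 1)"
  proof (rule mono_count_increments)
    show "g i \<le> g (Suc i)" for i unfolding g_def by (intro level_mono) simp_all
    show "J \<subseteq> {lo S 1..<hi S 1}" using cycle_bounds[OF S, of 1] by (auto simp: J_def)
    show "lo S 1 \<le> hi S 1" using lo_less_hi[OF S, of 1] by simp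
    fix j assume "j \<in> J"
    then have j: "(1, j) \<in> S" by (simp add: J_def)
    obtain y where y: "y \<in> S" "turn y = (1, j)" using cyclic_on_preimage[OF cycleD(1)[OF S] j] .
    have ys: "y \<in> steps" using y(1) cycleD(2)[OF S] by auto
    have "Suc (fst y) mod 3 = 1" using fst_turn[OF ys] y(2) by (metis fst_conv)
    then have "fst y = 0" using steps_fst[OF ys] by presburger
    then obtain i where i: "y = (0, i)" by (metis prod.collapse)
    have "fst (turn (1, j)) = 2" using fst_turn[of "(1, j)"] j cycleD(2)[OF S] by auto
    then obtain k where k: "turn (1, j) = (2, k)" by (metis prod.collapse)
    then have kS: "(2, k) \<in> S" using cycleD(5)[OF S j] by simp
    have js: "(1, j) \<in> steps" using j cycleD(2)[OF S] by auto
    let ?A = "F 0 (hi S 0)" and ?C = "F 2 (lo S 2)"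
    \<comment> \<open>Step \<open>k\<close> is not below \<open>lo S 2\<close>, so passing step
      \<open>j\<close> adds nothing to the intersection with \<open>?C\<close>. Of the terms of
      \<open>overlap\<close> only the dimension of \<open>?A \<inter> F 1 j\<close> grows, thanks to
      the vector \<open>x\<close> shared with step \<open>i\<close>.\<close>
    have "?C \<subseteq> F 2 k" using cycle_bounds(1)[OF S _ kS] by (intro F_mono) simp
    then have "F 1 (Suc j) \<inter> ?C \<subseteq> F 1 j" using turn_less(1)[OF js k] by blast
    then have C: "F 1 (Suc j) \<inter> ?C = F 1 j \<inter> ?C" using F_mono[of j "Suc j" 1] by auto
    have "F 0 (Suc i) \<subseteq> ?A"
      using cycle_bounds(2)[OF S _ y(1)[unfolded i]] by (intro F_mono) simp
    then obtain x where x: "x \<in> ?A" "x \<in> F 1 (Suc j)" "x \<notin> F 1 j"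
      using turn_less(3)[of 0 i 1 j] y(2) ys i by blast
    have "dim (?A \<inter> F 1 j) < dim (?A \<inter> F 1 (Suc j))"
      using x F_mono[of j "Suc j" 1] by (intro dim_less_subspace[of _ _ x] subspace_inter subspace_F) auto
    moreover have "?A \<inter> F 1 (Suc j) \<inter> ?C = ?A \<inter> F 1 j \<inter> ?C" using C by blast
    ultimately show "g j + 1 \<le> g (Suc j)"
      using C by (simp add: g_def level_def overlap_def)
  qed
  also have "\<dots> \<le> level (hi S 0) (hi S 1) (hi S 2)"
    unfolding g_def using lo_less_hi[OF S, of 2] by (intro level_mono) simp_all
  finally show ?thesis .
qed

text \<open>Here each pairwise dimension grows by 1, while the triple intersection stays the same.\<close>

lemma level_gain_triangle:
  assumes S: "cycle S" and card: "card S = 3" and hard: "\<not> halved hits S (card S)"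
  shows "level (lo S 0) (lo S 1) (lo S 2) + 3 \<le> level (hi S 0) (hi S 1) (hi S 2)"
proof -
  obtain i where i: "(0, i) \<in> S" using cycle_ex_type[OF S, of 0] by auto
  have iS: "(0, i) \<in> steps" using i cycleD(2)[OF S] by auto
  have "fst (turn (0, i)) = 1" using fst_turn[OF iS] by simp
  then obtain j where j: "turn (0, i) = (1, j)" by (metis prod.collapse)
  then have jS: "(1, j) \<in> steps" using turn_in_steps[OF iS] by simp
  have "fst (turn (1, j)) = 2" using fst_turn[OF jS] by simp
  then obtain k where k: "turn (1, j) = (2, k)" by (metis prod.collapse)
  then have kS: "(2, k) \<in> steps" using turn_in_steps[OF jS] by simp
  have three: "{..<3} = {0, 1, 2::nat}" by auto
  have pow: "(turn ^^ 2) (0, i) = (2, k)" using j k by (simp add: numeral_2_eq_2)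
  have Seq: "S = {(0, i), (1, j), (2, k)}"
    using cyclic_on_enumerate(1)[OF cycleD(1)[OF S] i] j pow by (simp add: card three)
  have close: "turn (2, k) = (0, i)"
    using cyclic_on_enumerate(3)[OF cycleD(1)[OF S] i] j k by (simp add: card numeral_3_eq_3)
  have cols: "{n. (0, n) \<in> S} = {i}" "{n. (1, n) \<in> S} = {j}" "{n. (2, n) \<in> S} = {k}"
    by (auto simp: Seq)
  \<comment> \<open>A vector common to the three steps would cover the cycle alone, within the
    budget of 3 half-vectors.\<close>
  have common: False if "x \<in> F 0 (Suc i)" "x \<notin> F 0 i" "x \<in> F 1 (Suc j)" "x \<notin> F 1 j"
    "x \<in> F 2 (Suc k)" "x \<notin> F 2 k" for x
  proof -
    have "x \<in> \<Inter>(hits ` S)" using that by (auto simp: Seq hits_def flag_step_def)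
    then have "covers hits S 1" by (intro covers_single) auto
    then show False using hard card unfolding halved_def by auto
  qed
  note left = turn_less(1)[OF iS j] turn_less(1)[OF jS k] turn_less(1)[OF kS close]
  note right = turn_less(2)[OF iS j] turn_less(2)[OF jS k] turn_less(2)[OF kS close]
  have up: "F t n \<subseteq> F t (Suc n)" for t n by (intro F_mono) simp
  have triple: "F 0 (Suc i) \<inter> F 1 (Suc j) \<inter> F 2 (Suc k) = F 0 i \<inter> F 1 j \<inter> F 2 k"
  proof (rule equalityI)
    show "F 0 (Suc i) \<inter> F 1 (Suc j) \<inter> F 2 (Suc k) \<subseteq> F 0 i \<inter> F 1 j \<inter> F 2 k"
    proof
      fix x assume x: "x \<in> F 0 (Suc i) \<inter> F 1 (Suc j) \<inter> F 2 (Suc k)"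
      \<comment> \<open>Inside the triple intersection, lying in the lower subspace of one flag is
        equivalent to lying in that of the next. So \<open>x\<close> is in all three or in none, and
        \<open>common\<close> excludes the latter.\<close>
      have "x \<in> F 0 i \<longleftrightarrow> x \<in> F 1 j" using x left(1) right(1) by blast
      moreover have "x \<in> F 1 j \<longleftrightarrow> x \<in> F 2 k" using x left(2) right(2) by blast
      ultimately show "x \<in> F 0 i \<inter> F 1 j \<inter> F 2 k" using x common[of x] by blast
    qed
  qed (intro Int_mono up)
  have pair: "dim (F t n \<inter> F s m) < dim (F t (Suc n) \<inter> F s (Suc m))"
    if tn: "(t, n) \<in> steps" "turn (t, n) = (s, m)" for t n s m
  proof -
    obtain x where "x \<in> F t (Suc n)" "x \<notin> F t n" "x \<in> F s (Suc m)"
      using turn_less(3)[OF tn] by blast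
    then show ?thesis using up[of t n] up[of s m]
      by (intro dim_less_subspace[of _ _ x] subspace_inter subspace_F) auto
  qed
  have "level i j k + 3 \<le> level (Suc i) (Suc j) (Suc k)"
    using pair[OF iS j] pair[OF jS k] pair[OF kS close] triple
    by (simp add: level_def overlap_def)
  then show ?thesis unfolding lo_def hi_def cols by simp
qed

lemma level_gain:
  assumes S: "cycle S" and hard: "\<not> halved hits S (card S)"
  shows "level (lo S 0) (lo S 1) (lo S 2) + 3 \<le> level (hi S 0) (hi S 1) (hi S 2)"
proof (cases "card S = 3")
  case True
  then show ?thesis using level_gain_triangle[OF S] hard by simp
next
  case False
  have "odd (card S)" using halved_cyclic[where f = turn and h = hits, OF cycleD(1,3)[OF S]] hard by blast
  \<comment> \<open>The length is an odd multiple of 3 other than 3.\<close>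
  then have "9 \<le> card S" using False cycle_card_dvd[OF S] by presburger
  then show ?thesis by (rule level_gain_long[OF S])
qed

section \<open>Counting the unpaired cycles and the vectors needed\<close>

lemma card_hard_cycles:
  assumes cyc: "\<And>S. S \<in> Q \<Longrightarrow> cycle S" and hard: "\<And>S. S \<in> Q \<Longrightarrow> \<not> halved hits S (card S)"
    and apart: "\<And>S T. S \<in> Q \<Longrightarrow> T \<in> Q \<Longrightarrow> S \<noteq> T \<Longrightarrow> below S T \<or> below T S"
    and fin: "finite Q"
  shows "3 * card Q \<le> DIM('a)"
proof -
  \<comment> \<open>The ranges of \<open>level\<close> across the cycles are disjoint integer
    intervals between 0 and the dimension, each with at least 3 elements.\<close>
  define I where "I S = {level (lo S 0) (lo S 1) (lo S 2)<..level (hi S 0) (hi S 1) (hi S 2)}" for S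
  have disj: "I S \<inter> I T = {}" if "S \<in> Q" "T \<in> Q" "below S T" for S T
  proof -
    have "level (hi S 0) (hi S 1) (hi S 2) \<le> level (lo T 0) (lo T 1) (lo T 2)"
      using that cyc by (intro level_mono below_hi_le_lo) simp_all
    then show ?thesis by (auto simp: I_def)
  qed
  have range: "I S \<subseteq> {0<..int DIM('a)}" if "S \<in> Q" for S
  proof -
    have "level 0 0 0 \<le> level (lo S 0) (lo S 1) (lo S 2)" by (intro level_mono) simp_all
    moreover have "level (hi S 0) (hi S 1) (hi S 2) \<le> level DIM('a) DIM('a) DIM('a)"
      using cyc[OF that] by (intro level_mono hi_le) simp_all
    ultimately show ?thesis by (auto simp: I_def level_zero level_full)
  qed
  have "3 \<le> card (I S)" if "S \<in> Q" for S
    using level_gain[OF cyc[OF that] hard[OF that]] by (simp add: I_def)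
  then have "3 * card Q \<le> (\<Sum>S\<in>Q. card (I S))"
    using sum_mono[of Q "\<lambda>_. 3::nat" "\<lambda>S. card (I S)"] by (simp add: mult.commute)
  also have "\<dots> = card (\<Union>S\<in>Q. I S)"
  proof (rule card_UN_disjoint[symmetric])
    show "\<forall>S\<in>Q. \<forall>T\<in>Q. S \<noteq> T \<longrightarrow> I S \<inter> I T = {}" using apart disj by blast
    show "\<forall>S\<in>Q. finite (I S)" by (simp add: I_def)
  qed (fact fin)
  also have "\<dots> \<le> card {0<..int DIM('a)}" using range by (intro card_mono) auto
  also have "\<dots> = DIM('a)" by simp
  finally show ?thesis .
qed

lemma covers_steps: "\<exists>k. covers hits steps k \<and> 3 * k \<le> 5 * DIM('a)"
proof -
  have fin: "finite steps" by (simp add: steps_def)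
  obtain P where P: "\<forall>S\<in>P. cyclic_on turn S" "\<Union>P = steps"
      "\<forall>S\<in>P. \<forall>T\<in>P. S \<noteq> T \<longrightarrow> S \<inter> T = {}"
    using permutes_decompose[OF turn_permutes fin] by (elim exE conjE) (rule that)
  have cyc: "cycle S" if "S \<in> P" for S using P(1,2) that by (auto simp: cycle_def)
  have finP: "finite P" using P(2) fin by (simp add: finite_UnionD)
  have disjP: "disjoint P" using P(3) by (simp add: disjoint_def)
  obtain Q where Q: "Q \<subseteq> P" "\<And>S. S \<in> Q \<Longrightarrow> \<not> halved hits S (card S)"
      "\<And>S T. S \<in> Q \<Longrightarrow> T \<in> Q \<Longrightarrow> S \<noteq> T \<Longrightarrow> \<not> halved hits (S \<union> T) (card S + card T)"
      "halved hits (\<Union>(P - Q)) (\<Sum>S\<in>P - Q. card S)"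
    using greedy_halving[OF finP, of hits] by metis
  have finQ: "finite Q" using Q(1) finP by (rule finite_subset)
  have cycQ: "cycle S" if "S \<in> Q" for S using cyc Q(1) that by auto
  have oddQ: "odd (card S)" if "S \<in> Q" for S
    using halved_cyclic[where f = turn and h = hits, OF cycleD(1,3)[OF cycQ[OF that]]] Q(2)[OF that] by blast
  have below: "below S T \<or> below T S" if ST: "S \<in> Q" "T \<in> Q" "S \<noteq> T" for S T
  proof (rule cycles_below_cases)
    show "cycle S" "cycle T" using cycQ ST by auto
    show "S \<inter> T = {}" using P(3) Q(1) ST by blast
    \<comment> \<open>A common vector would let the two odd cycles be halved jointly, against the
      choice of \<open>Q\<close>.\<close>
    show "hits y \<inter> hits z = {}" if "y \<in> S" "z \<in> T" for y z
      using halved_cyclic_join[of turn S hits y T z] cycleD(1,3)[OF cycQ[OF ST(1)]]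
        cycleD(1,3)[OF cycQ[OF ST(2)]] oddQ ST that Q(3)[OF ST] by blast
  qed
  have "halved hits (\<Union>Q) (\<Sum>S\<in>Q. Suc (card S))"
    using finQ halved_cyclic_Suc[where f = turn and h = hits, OF cycleD(1,3)[OF cycQ]] by (intro halved_Union)
  then have "halved hits (\<Union>(P - Q) \<union> \<Union>Q) ((\<Sum>S\<in>P - Q. card S) + (\<Sum>S\<in>Q. Suc (card S)))"
    using Q(4) by (intro halved_Un)
  moreover have "\<Union>(P - Q) \<union> \<Union>Q = steps" using Q(1) P(2) by blast
  moreover have "(\<Sum>S\<in>P - Q. card S) + (\<Sum>S\<in>Q. Suc (card S)) = (\<Sum>S\<in>P. card S) + card Q"
    using sum.subset_diff[OF Q(1) finP, of card] by (simp add: sum_Suc)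
  moreover have "(\<Sum>S\<in>P. card S) = 3 * DIM('a)"
  proof -
    have "(\<Sum>S\<in>P. card S) = card (\<Union>P)"
      using disjP cycleD(4)[OF cyc] by (subst card_Union_disjoint) auto
    then show ?thesis using P(2) by (simp add: steps_def)
  qed
  ultimately obtain k where "covers hits steps k" "2 * k \<le> 3 * DIM('a) + card Q"
    unfolding halved_def by auto
  moreover have "3 * card Q \<le> DIM('a)" by (rule card_hard_cycles[OF cycQ Q(2) below finQ])
  \<comment> \<open>With \<open>d\<close> the dimension and \<open>q\<close> the number of cycles in
    \<open>Q\<close>, \<open>2k <= 3d + q\<close> and \<open>3q <= d\<close> give
    \<open>6k <= 10d\<close>.\<close>
  ultimately show ?thesis by (intro exI[of _ k]) auto
qed

end

section \<open>Back to complete flags and generating sets\<close>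

lemma indexed_flag_complete:
  fixes U :: "nat \<Rightarrow> (real ^ 'n) set"
  assumes "complete_flag U"
  shows "indexed_flag (\<lambda>i. U (min i CARD('n)))"
proof -
  have "mono (\<lambda>i. U (min i CARD('n)))"
  proof (subst mono_iff_le_Suc, intro allI)
    fix i show "U (min i CARD('n)) \<subseteq> U (min (Suc i) CARD('n))"
      using assms by (cases "i < CARD('n)") (auto simp: complete_flag_def min_def)
  qed
  then show ?thesis using assms by (auto simp: indexed_flag_def complete_flag_def)
qed

text \<open>The spanning subset for \<open>U i\<close> is \<open>S \<inter> U i\<close>: each step
  contributes a vector of \<open>S\<close> that raises the dimension of the span, which stays inside
  the flag.\<close>

lemma generates_flagI:
  fixes U :: "nat \<Rightarrow> (real ^ 'n) set"
  assumes U: "complete_flag U" and S: "\<And>i. i < CARD('n) \<Longrightarrow> S \<inter> (U (Suc i) - U i) \<noteq> {}"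
  shows "generates_flag S U"
proof -
  have sub: "subspace (U i)" "dim (U i) = i" if "i \<le> CARD('n)" for i
    using U that unfolding complete_flag_def by auto
  have "span (S \<inter> U i) = U i" if "i \<le> CARD('n)" for i
    using that
  proof (induction i)
    case 0
    have "span (S \<inter> {0}) \<subseteq> {0}" by (intro span_minimal) (auto simp: subspace_single_0)
    moreover have "U 0 = {0}" using U by (simp add: complete_flag_def)
    ultimately show ?case using span_zero by fastforce
  next
    case (Suc i)
    then have IH: "span (S \<inter> U i) = U i" by simp
    have up: "U i \<subseteq> U (Suc i)"
      using U Suc.prems by (auto simp: complete_flag_def Suc_le_eq)
    obtain x where x: "x \<in> S" "x \<in> U (Suc i)" "x \<notin> U i" using S[of i] Suc.prems by auto
    have "U i \<subseteq> span (S \<inter> U (Suc i))" using IH up by (metis Int_mono order_refl span_mono)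
    moreover have "x \<in> span (S \<inter> U (Suc i))" using x by (intro span_base) simp
    ultimately have "dim (U i) < dim (span (S \<inter> U (Suc i)))"
      using x sub(1)[of i] Suc.prems by (intro dim_less_subspace[of _ _ x]) auto
    then have "dim (U (Suc i)) \<le> dim (span (S \<inter> U (Suc i)))"
      using sub(2)[of i] sub(2)[of "Suc i"] Suc.prems by simp
    moreover have "span (S \<inter> U (Suc i)) \<subseteq> U (Suc i)"
      using sub(1)[OF Suc.prems] by (intro span_minimal) auto
    ultimately show ?case
      using subspace_dim_equal[OF subspace_span sub(1)[OF Suc.prems]] by blast
  qed
  then show ?thesis unfolding generates_flag_def by (meson Int_lower1)
qed

lemma three_flags_generated:
  fixes U V W :: "nat \<Rightarrow> (real ^ 'n) set"
  assumes "complete_flag U" "complete_flag V" "complete_flag W"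
  shows "\<exists>S. finite S \<and> real (card S) \<le> 5 * real CARD('n) / 3 \<and>
    generates_flag S U \<and> generates_flag S V \<and> generates_flag S W"
proof -
  \<comment> \<open>All indices from 2 on yield \<open>W\<close>, since the locale asks for a flag
    at every index.\<close>
  define E where "E t = (if t = 0 then U else if t = 1 then V else W)" for t :: nat
  have E: "complete_flag (E t)" for t using assms by (simp add: E_def)
  interpret three_flags "\<lambda>t i. E t (min i CARD('n))"
    by unfold_locales (rule indexed_flag_complete[OF E])
  obtain k where k: "covers hits steps k" "3 * k \<le> 5 * CARD('n)" using covers_steps by auto
  then obtain S where S: "finite S" "card S \<le> k" "\<And>y. y \<in> steps \<Longrightarrow> S \<inter> hits y \<noteq> {}"
    unfolding covers_def by auto
  have gen: "generates_flag S (E t)" if "t < 3" for t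
  proof (rule generates_flagI[OF E])
    fix i assume i: "i < CARD('n)"
    then show "S \<inter> (E t (Suc i) - E t i) \<noteq> {}"
      using S(3)[of "(t, i)"] that by (simp add: steps_def hits_def flag_step_def)
  qed
  have "3 * card S \<le> 5 * CARD('n)" using S(2) k(2) by linarith
  then have "real (card S) \<le> 5 * real CARD('n) / 3" by simp
  then show ?thesis using S(1) gen[of 0] gen[of 1] gen[of 2] by (auto simp: E_def)
qed

theorem theorem4p5:
  shows "real (max_mu 3 TYPE('n::finite)) \<le> 5 * real CARD('n) / 3 \<and>
    (\<forall>U V W :: nat \<Rightarrow> (real ^ 'n) set.
       complete_flag U \<longrightarrow> complete_flag V \<longrightarrow> complete_flag W \<longrightarrow>
       (\<exists>S. finite S \<and> real (card S) \<le> 5 * real CARD('n) / 3 \<and>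
            generates_flag S U \<and> generates_flag S V \<and> generates_flag S W))"
proof (intro conjI allI impI three_flags_generated)
  \<comment> \<open>The maximum is attained by some triple of flags, so bounding that triple
    suffices.\<close>
  have "max_mu 3 TYPE('n) \<in> {flag_mu Us | Us :: (nat \<Rightarrow> (real ^ 'n) set) list.
      length Us = 3 \<and> (\<forall>U\<in>set Us. complete_flag U)}"
    unfolding max_mu_def by (rule Max_in[OF flag_mu_values_finite flag_mu_values_nonempty])
  then obtain Us :: "(nat \<Rightarrow> (real ^ 'n) set) list"
    where Us: "max_mu 3 TYPE('n) = flag_mu Us" "length Us = 3" "\<forall>U\<in>set Us. complete_flag U"
    by blast
  then obtain U V W where UVW: "Us = [U, V, W]" by (auto simp: length_Suc_conv numeral_3_eq_3)
  then obtain S where S: "finite S" "real (card S) \<le> 5 * real CARD('n) / 3"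
      "generates_flag S U" "generates_flag S V" "generates_flag S W"
    using three_flags_generated[of U V W] Us(3) by auto
  then have "flag_mu Us \<le> card S" by (intro flag_mu_le) (auto simp: UVW)
  then show "real (max_mu 3 TYPE('n)) \<le> 5 * real CARD('n) / 3" using S(2) Us(1) by linarith
qed

end
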